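(* Let $p$ be a prime and let $G=UT(4,p)$. Then the clique number of the commuting graph of $G$ is $\omega(\Gamma(G))=p^{4}$.
   Context: For a prime $p$, $UT(4,p)$ is the group, under matrix multiplication, of all $4\times 4$ upper triangular matrices over the finite field $\mathbb{F}_p$ with all diagonal entries equal to $1$. For a finite non-abelian group $G$, the commuting graph $\Gamma(G)$ has vertex set $G$ (central elements included), two distinct vertices $x,y$ being adjacent if and only if $xy=yx$. The clique number $\omega$ of a graph is the size of its largest clique (set of pairwise adjacent vertices). *)

theory Defs
  imports
    "HOL-Number_Theory.Residues"
    "Jordan_Normal_Form.Matrix"
    "Graph_Theory.Pair_Digraph"
begin

text \<open>
  The group of upper unitriangular \<open>n\<close> by \<open>n\<close> matrices over a HOL-Algebra ring \<open>R\<close>.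
  Matrix multiplication is written out because \<open>(*)\<close> on \<open>'a mat\<close> would use the type class
  operations of the entry type instead of the operations of \<open>R\<close> (for \<open>R = residue_ring p\<close>
  the entry type is \<^typ>\<open>int\<close>). Rows and columns are indexed by \<open>0, ..., n - 1\<close>.
\<close>

definition unitriangular_group :: "nat \<Rightarrow> ('a, 'm) ring_scheme \<Rightarrow> 'a mat monoid" where
  "unitriangular_group n R =
    \<lparr>carrier = {A \<in> carrier_mat n n.
        (\<forall>i<n. \<forall>j<n. A $$ (i, j) \<in> carrier R) \<and>
        (\<forall>i<n. \<forall>j<i. A $$ (i, j) = \<zero>\<^bsub>R\<^esub>) \<and>
        (\<forall>i<n. A $$ (i, i) = \<one>\<^bsub>R\<^esub>)},
     monoid.mult = \<lambda>A B. mat n n (\<lambda>(i, j).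
        \<Oplus>\<^bsub>R\<^esub>k\<in>{..<n}. A $$ (i, k) \<otimes>\<^bsub>R\<^esub> B $$ (k, j)),
     one = mat n n (\<lambda>(i, j). if i = j then \<one>\<^bsub>R\<^esub> else \<zero>\<^bsub>R\<^esub>)\<rparr>"

abbreviation UT :: "nat \<Rightarrow> nat \<Rightarrow> int mat monoid" where
  "UT n p \<equiv> unitriangular_group n (residue_ring (int p))"

text \<open>
  As usual in the library used here, a simple graph is a symmetric loop-free digraph.
\<close>

definition commuting_graph :: "('a, 'm) monoid_scheme \<Rightarrow> 'a pair_pre_digraph" where
  "commuting_graph G =
    \<lparr>pverts = carrier G,
     parcs = {(x, y). x \<in> carrier G \<and> y \<in> carrier G \<and> x \<noteq> y \<and>
                      x \<otimes>\<^bsub>G\<^esub> y = y \<otimes>\<^bsub>G\<^esub> x}\<rparr>"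

lemma pair_graph_commuting_graph:
  assumes "finite (carrier G)"
  shows "pair_graph (commuting_graph G)"
proof -
  have "parcs (commuting_graph G) \<subseteq> carrier G \<times> carrier G"
    by (auto simp: commuting_graph_def)
  then have "finite (parcs (commuting_graph G))"
    using assms by (meson finite_SigmaI finite_subset)
  then show ?thesis
    using assms
    by unfold_locales
      (auto simp: commuting_graph_def symmetric_def with_proj_simps intro!: symI)
qed

definition clique :: "'a pair_pre_digraph \<Rightarrow> 'a set \<Rightarrow> bool" where
  "clique \<Gamma> K \<longleftrightarrow> K \<subseteq> pverts \<Gamma> \<and> (\<forall>x\<in>K. \<forall>y\<in>K. x \<noteq> y \<longrightarrow> (x, y) \<in> parcs \<Gamma>)"

text \<open>Only meaningful for finite graphs, where the maximum exists.\<close>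

definition clique_number :: "'a pair_pre_digraph \<Rightarrow> nat" where
  "clique_number \<Gamma> = Max {card K | K. clique \<Gamma> K}"

end

theory Submission
  imports Defs
begin

text \<open>
  The argument works over any finite field \<open>R\<close> with \<open>q\<close> elements. Two elements \<open>A\<close>, \<open>B\<close> of
  \<open>UT(4, R)\<close> commute if and only if three alternating bilinear forms in the entries above the
  diagonal vanish on them (\<open>unitriangular4_commute_iff\<close>); they compare positions
  \<open>(0, 2)\<close>, \<open>(1, 3)\<close> and \<open>(0, 3)\<close> of \<open>A B\<close> and \<open>B A\<close>.

  For the upper bound, fix a set \<open>K\<close> of pairwise commuting matrices. One member of \<open>K\<close> with a
  nonzero entry on the superdiagonal turns the three forms into linear equations satisfied by all of
  \<open>K\<close>, and dividing by that entry expresses some of the six entries above the diagonal by the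
  others. If there is no such member, only three entries are left to vary. In every case four of the
  entries determine a member of \<open>K\<close>
  (\<open>commuting_unitriangular4_determined_by_four_entries\<close>), so \<open>K\<close> has at most \<open>q\<^sup>4\<close> elements.
  The bound is attained by the matrices whose only nonzero entries off the diagonal lie in the
  upper right \<open>2 \<times> 2\<close> block, since the product of two of them just adds the blocks.
\<close>

lemma mat4_eqI:
  assumes "A \<in> carrier_mat 4 4" "B \<in> carrier_mat 4 4"
    and "\<And>i j. i \<in> {0, 1, 2, 3} \<Longrightarrow> j \<in> {0, 1, 2, 3} \<Longrightarrow> A $$ (i, j) = B $$ (i, j)"
  shows "A = B"
proof (rule eq_matI)
  fix i j assume "i < dim_row B" "j < dim_col B"
  then have "i \<in> {0, 1, 2, 3}" "j \<in> {0, 1, 2, 3}"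
    using assms(2) by auto
  then show "A $$ (i, j) = B $$ (i, j)"
    by (rule assms(3))
qed (use assms in auto)

context field
begin

abbreviation "UT4 \<equiv> unitriangular_group 4 R"

lemma unitriangular4_entries:
  assumes "A \<in> carrier UT4"
  shows "A \<in> carrier_mat 4 4"
    and "i < 4 \<Longrightarrow> j < 4 \<Longrightarrow> A $$ (i, j) \<in> carrier R"
    and "j < i \<Longrightarrow> i < 4 \<Longrightarrow> A $$ (i, j) = \<zero>"
    and "i < 4 \<Longrightarrow> A $$ (i, i) = \<one>"
  using assms by (auto simp: unitriangular_group_def)

lemma unitriangular4_eqI:
  assumes A: "A \<in> carrier UT4" and B: "B \<in> carrier UT4"
    and "A $$ (0, 1) = B $$ (0, 1)" "A $$ (1, 2) = B $$ (1, 2)" "A $$ (2, 3) = B $$ (2, 3)"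
    and "A $$ (0, 2) = B $$ (0, 2)" "A $$ (1, 3) = B $$ (1, 3)" "A $$ (0, 3) = B $$ (0, 3)"
  shows "A = B"
  by (rule mat4_eqI)
    (use assms(3-) unitriangular4_entries[OF A] unitriangular4_entries[OF B] in auto)

lemma unitriangular4_mult:
  assumes A: "A \<in> carrier UT4" and B: "B \<in> carrier UT4"
  shows "A \<otimes>\<^bsub>UT4\<^esub> B \<in> carrier_mat 4 4"
    and "i < 4 \<Longrightarrow> j < 4 \<Longrightarrow> (A \<otimes>\<^bsub>UT4\<^esub> B) $$ (i, j) =
      A $$ (i, 0) \<otimes> B $$ (0, j) \<oplus> (A $$ (i, 1) \<otimes> B $$ (1, j) \<oplus>
      (A $$ (i, 2) \<otimes> B $$ (2, j) \<oplus> A $$ (i, 3) \<otimes> B $$ (3, j)))"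
proof -
  show "A \<otimes>\<^bsub>UT4\<^esub> B \<in> carrier_mat 4 4"
    by (simp add: unitriangular_group_def)
  assume ij: "i < 4" "j < 4"
  have "{..<4::nat} = {0, 1, 2, 3}"
    by auto
  then show "(A \<otimes>\<^bsub>UT4\<^esub> B) $$ (i, j) =
      A $$ (i, 0) \<otimes> B $$ (0, j) \<oplus> (A $$ (i, 1) \<otimes> B $$ (1, j) \<oplus>
      (A $$ (i, 2) \<otimes> B $$ (2, j) \<oplus> A $$ (i, 3) \<otimes> B $$ (3, j)))"
    using ij unitriangular4_entries[OF A] unitriangular4_entries[OF B]
    by (simp add: unitriangular_group_def)
qed

text \<open>
  On and below the diagonal and on the superdiagonal, \<open>A B\<close> and \<open>B A\<close> agree automatically. In the
  remaining three positions the terms linear in the entries of \<open>A\<close> and of \<open>B\<close> are the same on both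
  sides and cancel, which leaves the quadratic terms.
\<close>

lemma unitriangular4_commute_iff:
  assumes A: "A \<in> carrier UT4" and B: "B \<in> carrier UT4"
  shows "A \<otimes>\<^bsub>UT4\<^esub> B = B \<otimes>\<^bsub>UT4\<^esub> A \<longleftrightarrow>
    A $$ (0, 1) \<otimes> B $$ (1, 2) = B $$ (0, 1) \<otimes> A $$ (1, 2) \<and>
    A $$ (1, 2) \<otimes> B $$ (2, 3) = B $$ (1, 2) \<otimes> A $$ (2, 3) \<and>
    A $$ (0, 1) \<otimes> B $$ (1, 3) \<oplus> A $$ (0, 2) \<otimes> B $$ (2, 3) =
      B $$ (0, 1) \<otimes> A $$ (1, 3) \<oplus> B $$ (0, 2) \<otimes> A $$ (2, 3)"
    (is "_ \<longleftrightarrow> ?forms")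
proof -
  note entries = unitriangular4_entries[OF A] unitriangular4_entries[OF B]
  note mult = unitriangular4_mult[OF A B] unitriangular4_mult[OF B A]
  have cancel: "x \<oplus> (u \<oplus> y) = y \<oplus> (v \<oplus> x) \<longleftrightarrow> u = v"
    if "x \<in> carrier R" "y \<in> carrier R" "u \<in> carrier R" "v \<in> carrier R" for x y u v
  proof -
    have "x \<oplus> (u \<oplus> y) = (x \<oplus> y) \<oplus> u" "y \<oplus> (v \<oplus> x) = (x \<oplus> y) \<oplus> v"
      using that by (simp_all add: a_ac)
    then show ?thesis
      using that by simp
  qed
  let ?AB = "A \<otimes>\<^bsub>UT4\<^esub> B" and ?BA = "B \<otimes>\<^bsub>UT4\<^esub> A"
  have e02: "?AB $$ (0, 2) = ?BA $$ (0, 2) \<longleftrightarrow>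
      A $$ (0, 1) \<otimes> B $$ (1, 2) = B $$ (0, 1) \<otimes> A $$ (1, 2)"
    using cancel[of "B $$ (0, 2)" "A $$ (0, 2)"] by (simp add: mult entries)
  have e13: "?AB $$ (1, 3) = ?BA $$ (1, 3) \<longleftrightarrow>
      A $$ (1, 2) \<otimes> B $$ (2, 3) = B $$ (1, 2) \<otimes> A $$ (2, 3)"
    using cancel[of "B $$ (1, 3)" "A $$ (1, 3)"] by (simp add: mult entries)
  have e03: "?AB $$ (0, 3) = ?BA $$ (0, 3) \<longleftrightarrow>
      A $$ (0, 1) \<otimes> B $$ (1, 3) \<oplus> A $$ (0, 2) \<otimes> B $$ (2, 3) =
      B $$ (0, 1) \<otimes> A $$ (1, 3) \<oplus> B $$ (0, 2) \<otimes> A $$ (2, 3)"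
    using cancel[of "B $$ (0, 3)" "A $$ (0, 3)"
        "A $$ (0, 1) \<otimes> B $$ (1, 3) \<oplus> A $$ (0, 2) \<otimes> B $$ (2, 3)"
        "B $$ (0, 1) \<otimes> A $$ (1, 3) \<oplus> B $$ (0, 2) \<otimes> A $$ (2, 3)"]
    by (simp add: mult entries a_assoc)
  show ?thesis
  proof
    assume "?AB = ?BA"
    then show ?forms
      using e02 e13 e03 by simp
  next
    assume forms: ?forms
    show "?AB = ?BA"
    proof (rule mat4_eqI[OF mult(1,3)])
      fix i j :: nat assume "i \<in> {0, 1, 2, 3}" "j \<in> {0, 1, 2, 3}"
      then consider "(i, j) \<in> {(0, 2), (1, 3), (0, 3)}" | "j < i" "i < 4" | "i = j" "i < 4"
        | "(i, j) \<in> {(0, 1), (1, 2), (2, 3)}"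
        by auto
      then show "?AB $$ (i, j) = ?BA $$ (i, j)"
      proof cases
        case 1
        then show ?thesis using forms e02 e13 e03 by auto
      next
        case 2
        then have "(i, j) \<in> {(1, 0), (2, 0), (3, 0), (2, 1), (3, 1), (3, 2)}" by auto
        then show ?thesis by (auto simp: mult entries)
      next
        case 3
        then have "(i, j) \<in> {(0, 0), (1, 1), (2, 2), (3, 3)}" by auto
        then show ?thesis by (auto simp: mult entries)
      next
        case 4
        then show ?thesis by (auto simp: mult entries a_comm)
      qed
    qed
  qed
qed

text \<open>
  The middle superdiagonal entry occurs in the forms at \<open>(0, 2)\<close> and \<open>(1, 3)\<close>, so a member of \<open>K\<close> in
  which it is nonzero eliminates two of the six entries at once. If it vanishes on all of \<open>K\<close>, five
  entries are left, and a nonzero entry at \<open>(0, 1)\<close> or \<open>(2, 3)\<close> lets the form at \<open>(0, 3)\<close> eliminate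
  one of these.
\<close>

lemma commuting_unitriangular4_determined_by_four_entries:
  assumes K: "K \<subseteq> carrier UT4"
    and comm: "\<forall>A\<in>K. \<forall>B\<in>K. A \<otimes>\<^bsub>UT4\<^esub> B = B \<otimes>\<^bsub>UT4\<^esub> A"
  obtains r s t u where "{r, s, t, u} \<subseteq> {..<4} \<times> {..<4}"
    and "inj_on (\<lambda>A. (A $$ r, A $$ s, A $$ t, A $$ u)) K"
proof -
  have UT4: "A \<in> carrier UT4" if "A \<in> K" for A
    using K that by blast
  note entry = unitriangular4_entries(2)[OF UT4]
  have f02: "A $$ (0, 1) \<otimes> B $$ (1, 2) = B $$ (0, 1) \<otimes> A $$ (1, 2)"
    and f13: "A $$ (1, 2) \<otimes> B $$ (2, 3) = B $$ (1, 2) \<otimes> A $$ (2, 3)"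
    and f03: "A $$ (0, 1) \<otimes> B $$ (1, 3) \<oplus> A $$ (0, 2) \<otimes> B $$ (2, 3) =
      B $$ (0, 1) \<otimes> A $$ (1, 3) \<oplus> B $$ (0, 2) \<otimes> A $$ (2, 3)"
    if "A \<in> K" "B \<in> K" for A B
    using comm unitriangular4_commute_iff[OF UT4 UT4, OF that] that by auto
  consider (mid) X where "X \<in> K" "X $$ (1, 2) \<noteq> \<zero>"
    | (first) X where "X \<in> K" "X $$ (0, 1) \<noteq> \<zero>" "\<forall>A\<in>K. A $$ (1, 2) = \<zero>"
    | (last) X where "X \<in> K" "X $$ (2, 3) \<noteq> \<zero>"
        "\<forall>A\<in>K. A $$ (1, 2) = \<zero> \<and> A $$ (0, 1) = \<zero>"
    | (none) "\<forall>A\<in>K. A $$ (1, 2) = \<zero> \<and> A $$ (0, 1) = \<zero> \<and> A $$ (2, 3) = \<zero>"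
    by blast
  then show thesis
  proof cases
    case mid
    have "inj_on (\<lambda>A. (A $$ (1, 2), A $$ (0, 2), A $$ (1, 3), A $$ (0, 3))) K"
    proof (rule inj_onI)
      fix A B assume AB: "A \<in> K" "B \<in> K"
        and eq: "(A $$ (1, 2), A $$ (0, 2), A $$ (1, 3), A $$ (0, 3)) =
          (B $$ (1, 2), B $$ (0, 2), B $$ (1, 3), B $$ (0, 3))"
      have "A $$ (0, 1) \<otimes> X $$ (1, 2) = B $$ (0, 1) \<otimes> X $$ (1, 2)"
        using f02[OF mid(1) AB(1)] f02[OF mid(1) AB(2)] eq by simp
      then have 1: "A $$ (0, 1) = B $$ (0, 1)"
        using mid AB by (simp add: m_rcancel entry)
      have "X $$ (1, 2) \<otimes> A $$ (2, 3) = X $$ (1, 2) \<otimes> B $$ (2, 3)"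
        using f13[OF mid(1) AB(1)] f13[OF mid(1) AB(2)] eq by simp
      then have "A $$ (2, 3) = B $$ (2, 3)"
        using mid AB by (simp add: m_lcancel entry)
      then show "A = B"
        using 1 eq by (intro unitriangular4_eqI UT4 AB) auto
    qed
    then show thesis by (rule that[rotated]) auto
  next
    case first
    have "inj_on (\<lambda>A. (A $$ (0, 1), A $$ (2, 3), A $$ (0, 2), A $$ (0, 3))) K"
    proof (rule inj_onI)
      fix A B assume AB: "A \<in> K" "B \<in> K"
        and eq: "(A $$ (0, 1), A $$ (2, 3), A $$ (0, 2), A $$ (0, 3)) =
          (B $$ (0, 1), B $$ (2, 3), B $$ (0, 2), B $$ (0, 3))"
      have "X $$ (0, 1) \<otimes> A $$ (1, 3) \<oplus> X $$ (0, 2) \<otimes> A $$ (2, 3) =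
          X $$ (0, 1) \<otimes> B $$ (1, 3) \<oplus> X $$ (0, 2) \<otimes> A $$ (2, 3)"
        using f03[OF first(1) AB(1)] f03[OF first(1) AB(2)] eq by simp
      then have "A $$ (1, 3) = B $$ (1, 3)"
        using first AB by (simp add: m_lcancel entry add.right_cancel)
      then show "A = B"
        using first(3) AB eq by (intro unitriangular4_eqI UT4 AB) auto
    qed
    then show thesis by (rule that[rotated]) auto
  next
    case last
    have "inj_on (\<lambda>A. (A $$ (1, 2), A $$ (2, 3), A $$ (1, 3), A $$ (0, 3))) K"
    proof (rule inj_onI)
      fix A B assume AB: "A \<in> K" "B \<in> K"
        and eq: "(A $$ (1, 2), A $$ (2, 3), A $$ (1, 3), A $$ (0, 3)) =
          (B $$ (1, 2), B $$ (2, 3), B $$ (1, 3), B $$ (0, 3))"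
      have "A $$ (0, 2) \<otimes> X $$ (2, 3) = B $$ (0, 2) \<otimes> X $$ (2, 3)"
        using f03[OF last(1) AB(1)] f03[OF last(1) AB(2)] eq last AB by (simp add: entry)
      then have "A $$ (0, 2) = B $$ (0, 2)"
        using last AB by (simp add: m_rcancel entry)
      then show "A = B"
        using last(3) AB eq by (intro unitriangular4_eqI UT4 AB) auto
    qed
    then show thesis by (rule that[rotated]) auto
  next
    case none
    have "inj_on (\<lambda>A. (A $$ (1, 2), A $$ (0, 2), A $$ (1, 3), A $$ (0, 3))) K"
      using none by (intro inj_onI unitriangular4_eqI UT4) auto
    then show thesis by (rule that[rotated]) auto
  qed
qed

lemma card_clique_unitriangular4_le:
  assumes fin: "finite (carrier R)" and K: "clique (commuting_graph UT4) K"
  shows "card K \<le> card (carrier R) ^ 4"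
proof -
  have sub: "K \<subseteq> carrier UT4"
    using K by (simp add: clique_def commuting_graph_def)
  have comm: "\<forall>A\<in>K. \<forall>B\<in>K. A \<otimes>\<^bsub>UT4\<^esub> B = B \<otimes>\<^bsub>UT4\<^esub> A"
  proof (intro ballI)
    fix A B assume "A \<in> K" "B \<in> K"
    then show "A \<otimes>\<^bsub>UT4\<^esub> B = B \<otimes>\<^bsub>UT4\<^esub> A"
      using K unfolding clique_def commuting_graph_def by (cases "A = B") auto
  qed
  obtain r s t u where pos: "{r, s, t, u} \<subseteq> {..<4} \<times> {..<4}"
    and inj: "inj_on (\<lambda>A. (A $$ r, A $$ s, A $$ t, A $$ u)) K"
    by (rule commuting_unitriangular4_determined_by_four_entries[OF sub comm])
  have "A $$ x \<in> carrier R" if "A \<in> K" "x \<in> {r, s, t, u}" for A x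
  proof -
    have "A \<in> carrier UT4" "fst x < 4" "snd x < 4"
      using that pos sub by auto
    then show ?thesis
      using unitriangular4_entries(2)[of A "fst x" "snd x"] by simp
  qed
  then have "(\<lambda>A. (A $$ r, A $$ s, A $$ t, A $$ u)) ` K
      \<subseteq> carrier R \<times> carrier R \<times> carrier R \<times> carrier R"
    by (intro image_subsetI) simp
  then have "card K \<le> card (carrier R \<times> carrier R \<times> carrier R \<times> carrier R)"
    using fin by (intro card_inj_on_le[OF inj]) auto
  then show ?thesis
    by (simp add: card_cartesian_product power4_eq_xxxx mult.assoc)
qed

text \<open>
  When both outer superdiagonal entries vanish, all three forms vanish term by term. The four
  entries that remain free form the upper right block.
\<close>

lemma clique_unitriangular4_block:
  "clique (commuting_graph UT4) {A \<in> carrier UT4. A $$ (0, 1) = \<zero> \<and> A $$ (2, 3) = \<zero>}"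
  by (auto simp: clique_def commuting_graph_def unitriangular4_commute_iff unitriangular4_entries)

lemma card_unitriangular4_block:
  "card {A \<in> carrier UT4. A $$ (0, 1) = \<zero> \<and> A $$ (2, 3) = \<zero>} = card (carrier R) ^ 4"
    (is "card ?K = _")
proof -
  let ?M = "\<lambda>(w, x, y, z). mat 4 4 (\<lambda>(i, j). if i = j then \<one> else
    if (i, j) = (0, 2) then w else if (i, j) = (0, 3) then x else
    if (i, j) = (1, 2) then y else if (i, j) = (1, 3) then z else \<zero>)"
  let ?E = "\<lambda>A. (A $$ (0, 2), A $$ (0, 3), A $$ (1, 2), A $$ (1, 3))"
  let ?Q = "carrier R \<times> carrier R \<times> carrier R \<times> carrier R"
  have "bij_betw ?E ?K ?Q"
  proof (rule bij_betwI[where g = ?M])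
    show "?E \<in> ?K \<rightarrow> ?Q"
      by (auto simp: unitriangular4_entries)
    show M: "?M \<in> ?Q \<rightarrow> ?K"
      by (auto simp: unitriangular_group_def)
    show "?M (?E A) = A" if "A \<in> ?K" for A
    proof -
      have "?M (?E A) \<in> ?K"
        using that by (intro funcset_mem[OF M]) (auto simp: unitriangular4_entries)
      then show ?thesis
        using that by (intro unitriangular4_eqI) auto
    qed
    show "?E (?M v) = v" for v
      by (cases v) simp
  qed
  then have "card ?K = card ?Q"
    by (rule bij_betw_same_card)
  then show ?thesis
    by (simp add: card_cartesian_product power4_eq_xxxx mult.assoc)
qed

theorem clique_number_commuting_graph_unitriangular4:
  assumes "finite (carrier R)"
  shows "clique_number (commuting_graph UT4) = card (carrier R) ^ 4"
  unfolding clique_number_def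
proof (rule Max_eqI)
  let ?sizes = "{card K |K. clique (commuting_graph UT4) K}"
  show "n \<le> card (carrier R) ^ 4" if n: "n \<in> ?sizes" for n
  proof -
    obtain K where "n = card K" "clique (commuting_graph UT4) K"
      using n by blast
    then show ?thesis
      using card_clique_unitriangular4_le[OF assms] by simp
  qed
  then have "?sizes \<subseteq> {..card (carrier R) ^ 4}"
    by (intro subsetI) (rule atMost_iff[THEN iffD2])
  then show "finite ?sizes"
    by (rule finite_subset) (rule finite_atMost)
  show "card (carrier R) ^ 4 \<in> ?sizes"
    by (intro CollectI exI conjI)
      (rule card_unitriangular4_block[symmetric], rule clique_unitriangular4_block)
qed

end

theorem proposition3p5:
  fixes p :: nat
  assumes "prime p"
  shows "clique_number (commuting_graph (UT 4 p)) = p ^ 4"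
proof -
  interpret residues_prime p "residue_ring (int p)"
    using assms by unfold_locales simp_all
  interpret field "residue_ring (int p)"
    by (rule is_field)
  have "carrier (residue_ring (int p)) = {0..int p - 1}"
    by (rule res_carrier_eq)
  then show ?thesis
    using clique_number_commuting_graph_unitriangular4 by simp
qed

end
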